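(* Let $G$ and $H$ be graphs of orders $m\ge 1$ and $n\ge 1$, respectively, and let $G\times H$ denote their Cartesian product. Then $\gamma_{ds}(G\times H)=mn$ if and only if $\Delta(G)+\Delta(H)\le 1$.
   Context: All graphs are finite, simple and undirected; $\Delta(G)$ denotes the maximum degree of $G$, and the order of a graph is its number of vertices. A set $S\subseteq V(G)$ is a dual-server dominating set (DS-dominating set) of a graph $G$ if there is a partition $\{R,B\}$ of $S$ (where a part is allowed to be empty) such that every vertex of $V(G)\setminus S$ has at least one neighbour in $R$ and at least one neighbour in $B$. The dual-server domination number $\gamma_{ds}(G)$ is the minimum cardinality of a DS-dominating set of $G$. The Cartesian product $G\times H$ has vertex set $V(G)\times V(H)$, and $(u_1,u_2)$ is adjacent to $(v_1,v_2)$ if and only if either $u_1=v_1$ and $u_2v_2\in E(H)$, or $u_2=v_2$ and $u_1v_1\in E(G)$. *)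

theory Defs
  imports "Graph_Theory.Pair_Digraph"
begin

text \<open>
  A finite simple undirected graph is a \<open>pair_graph\<close>, i.e. a finite, loop-free, symmetric set of
  arcs without parallel arcs. An undirected edge \<open>uv\<close> is thus the pair of arcs \<open>(u, v)\<close>, \<open>(v, u)\<close>, and
  the degree of a vertex is its \<open>out_degree\<close> (not the sum of in- and out-degree).
\<close>

text \<open>Meaningful for finite graphs with at least one vertex; otherwise \<open>Max\<close> is unspecified.\<close>

definition max_degree :: "'a pair_pre_digraph \<Rightarrow> nat" where
  "max_degree G = Max (out_degree G ` pverts G)"

definition cartesian_product ::
    "'a pair_pre_digraph \<Rightarrow> 'b pair_pre_digraph \<Rightarrow> ('a \<times> 'b) pair_pre_digraph" where
  "cartesian_product G H =
     \<lparr> pverts = pverts G \<times> pverts H,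
       parcs = {((u1, u2), (v1, v2)) | u1 u2 v1 v2.
                  (u1, u2) \<in> pverts G \<times> pverts H \<and> (v1, v2) \<in> pverts G \<times> pverts H \<and>
                  (u1 = v1 \<and> (u2, v2) \<in> parcs H \<or> u2 = v2 \<and> (u1, v1) \<in> parcs G)} \<rparr>"

definition ds_dominating_set :: "'a pair_pre_digraph \<Rightarrow> 'a set \<Rightarrow> bool" where
  "ds_dominating_set G S \<longleftrightarrow>
     S \<subseteq> pverts G \<and>
     (\<exists>R B. R \<union> B = S \<and> R \<inter> B = {} \<and>
        (\<forall>v \<in> pverts G - S. (\<exists>r \<in> R. (v, r) \<in> parcs G) \<and> (\<exists>b \<in> B. (v, b) \<in> parcs G)))"

text \<open>The set of cardinalities is never empty: \<open>pverts G\<close> itself is a DS-dominating set.\<close>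

definition ds_domination_number :: "'a pair_pre_digraph \<Rightarrow> nat" where
  "ds_domination_number G = (LEAST k. \<exists>S. ds_dominating_set G S \<and> card S = k)"

lemma pair_graph_cartesian_product:
  assumes "pair_graph G" "pair_graph H"
  shows "pair_graph (cartesian_product G H)"
proof -
  interpret G: pair_graph G by fact
  interpret H: pair_graph H by fact
  have "parcs (cartesian_product G H) \<subseteq> (pverts G \<times> pverts H) \<times> (pverts G \<times> pverts H)"
    by (auto simp: cartesian_product_def)
  then have "finite (parcs (cartesian_product G H))"
    by (rule finite_subset) (simp add: G.pair_finite_verts H.pair_finite_verts)
  moreover have "symmetric (cartesian_product G H)"
    by (auto simp: symmetric_def cartesian_product_def intro!: symI
        dest: G.arcs_symmetric H.arcs_symmetric)
  ultimately show ?thesis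
    by unfold_locales
      (auto simp: cartesian_product_def G.pair_finite_verts H.pair_finite_verts
        dest: G.no_loops' H.no_loops')
qed

end

theory Submission
  imports Defs
begin

text \<open>
  A graph has a DS-dominating set other than its whole vertex set exactly if some vertex has two
  distinct neighbours: a vertex outside the set needs a neighbour in each of two disjoint parts,
  and conversely a vertex \<open>v\<close> with distinct neighbours \<open>r\<close> and \<open>b\<close> can be left out by putting
  \<open>r\<close> and \<open>b\<close> in different parts. Hence the dual-server domination number equals the order if
  and only if the maximum degree is at most 1 (\<open>ds_domination_number_eq_order_iff\<close>). Degrees add
  in a Cartesian product, since the neighbours of \<open>(u, w)\<close> along the two factors are disjoint sets;
  so the maximum degree of the product is the sum of those of the factors
  (\<open>max_degree_cartesian_product\<close>).
\<close>

lemma out_degree_eq_card_nbrs: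
  fixes G :: "'a pair_pre_digraph"
  shows "out_degree G v = card {w. (v, w) \<in> parcs G}"
proof -
  have "out_arcs G v = Pair v ` {w. (v, w) \<in> parcs G}"
    by (auto simp: out_arcs_def)
  then show ?thesis
    by (simp add: out_degree_def card_image inj_on_def)
qed

lemma (in pair_graph) finite_nbrs: "finite {w. (v, w) \<in> parcs G}"
  by (rule finite_subset[OF _ pair_finite_verts]) (auto dest: in_arcsD2)

lemma (in pair_graph) max_degree_ge: "v \<in> pverts G \<Longrightarrow> out_degree G v \<le> max_degree G"
  unfolding max_degree_def by (rule Max_ge) (auto simp: pair_finite_verts)

lemma (in pair_graph) max_degree_attained:
  assumes "pverts G \<noteq> {}"
  obtains v where "v \<in> pverts G" "out_degree G v = max_degree G"
proof -
  have "max_degree G \<in> out_degree G ` pverts G"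
    unfolding max_degree_def using assms by (intro Max_in) (auto simp: pair_finite_verts)
  then show ?thesis using that by auto
qed

lemma (in pair_graph) ds_dominating_set_pverts: "ds_dominating_set G (pverts G)"
  unfolding ds_dominating_set_def by auto

lemma (in pair_graph) two_nbrs_if_not_in_ds_dominating_set:
  assumes "ds_dominating_set G S" and "v \<in> pverts G" and "v \<notin> S"
  shows "out_degree G v \<ge> 2"
proof -
  obtain r b where "(v, r) \<in> parcs G" "(v, b) \<in> parcs G" "r \<noteq> b"
    using assms unfolding ds_dominating_set_def by blast
  then have "card {r, b} \<le> card {w. (v, w) \<in> parcs G}"
    by (intro card_mono finite_nbrs) auto
  then show ?thesis
    using \<open>r \<noteq> b\<close> by (simp add: out_degree_eq_card_nbrs)
qed

lemma (in pair_graph) ds_dominating_set_remove_vertex: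
  assumes "out_degree G v \<ge> 2"
  shows "ds_dominating_set G (pverts G - {v})"
proof -
  obtain T where "T \<subseteq> {w. (v, w) \<in> parcs G}" and "card T = 2"
    using obtain_subset_with_card_n[of 2] assms unfolding out_degree_eq_card_nbrs by blast
  then obtain r b where rb: "(v, r) \<in> parcs G" "(v, b) \<in> parcs G" "r \<noteq> b"
    by (auto simp: card_2_iff)
  then have "r \<in> pverts G - {v}" "b \<in> pverts G - {v}"
    using no_loops' in_arcsD2 by auto
  with rb show ?thesis
    unfolding ds_dominating_set_def
    by (intro conjI exI[of _ "{r}"] exI[of _ "pverts G - {v} - {r}"]) auto
qed

lemma (in pair_graph) ds_domination_number_eq_order_iff:
  assumes "pverts G \<noteq> {}"
  shows "ds_domination_number G = card (pverts G) \<longleftrightarrow> max_degree G \<le> 1"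
proof
  assume order: "ds_domination_number G = card (pverts G)"
  obtain v where v: "v \<in> pverts G" "out_degree G v = max_degree G"
    using max_degree_attained[OF assms] .
  show "max_degree G \<le> 1"
  proof (rule ccontr)
    assume "\<not> max_degree G \<le> 1"
    then have "ds_dominating_set G (pverts G - {v})"
      using v by (intro ds_dominating_set_remove_vertex) simp
    then have "ds_domination_number G \<le> card (pverts G - {v})"
      unfolding ds_domination_number_def by (intro Least_le) blast
    also have "\<dots> < card (pverts G)"
      using v pair_finite_verts by (intro card_Diff1_less)
    finally show False using order by simp
  qed
next
  assume deg: "max_degree G \<le> 1"
  have whole: "S = pverts G" if S: "ds_dominating_set G S" for S
  proof -
    have "v \<in> S" if "v \<in> pverts G" for v
      using two_nbrs_if_not_in_ds_dominating_set[OF S that] max_degree_ge[OF that] deg by linarith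
    then show ?thesis
      using S unfolding ds_dominating_set_def by blast
  qed
  show "ds_domination_number G = card (pverts G)"
    unfolding ds_domination_number_def
    by (rule Least_equality) (use ds_dominating_set_pverts in \<open>auto dest: whole\<close>)
qed

lemma pverts_cartesian_product:
  "pverts (cartesian_product G H) = pverts G \<times> pverts H"
  by (simp add: cartesian_product_def)

lemma out_degree_cartesian_product:
  assumes "pair_graph G" "pair_graph H" "u \<in> pverts G" "w \<in> pverts H"
  shows "out_degree (cartesian_product G H) (u, w) = out_degree G u + out_degree H w"
proof -
  interpret G: pair_graph G by fact
  interpret H: pair_graph H by fact
  let ?NG = "(\<lambda>x. (x, w)) ` {x. (u, x) \<in> parcs G}"
  let ?NH = "Pair u ` {y. (w, y) \<in> parcs H}"
  have "{z. ((u, w), z) \<in> parcs (cartesian_product G H)} = ?NG \<union> ?NH"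
    using assms(3,4) by (auto simp: cartesian_product_def dest: G.in_arcsD2 H.in_arcsD2)
  moreover have "?NG \<inter> ?NH = {}"
    using G.no_loops' by auto
  ultimately show ?thesis
    by (simp add: out_degree_eq_card_nbrs card_Un_disjoint G.finite_nbrs H.finite_nbrs
        card_image inj_on_def)
qed

lemma max_degree_cartesian_product:
  assumes "pair_graph G" "pair_graph H" "pverts G \<noteq> {}" "pverts H \<noteq> {}"
  shows "max_degree (cartesian_product G H) = max_degree G + max_degree H"
proof -
  interpret G: pair_graph G by fact
  interpret H: pair_graph H by fact
  interpret P: pair_graph "cartesian_product G H"
    by (rule pair_graph_cartesian_product) fact+
  have nonempty: "pverts (cartesian_product G H) \<noteq> {}"
    using assms(3,4) by (simp add: pverts_cartesian_product)
  note deg = out_degree_cartesian_product[OF assms(1,2)]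
  show ?thesis
  proof (rule antisym)
    obtain p where "p \<in> pverts (cartesian_product G H)"
        and "out_degree (cartesian_product G H) p = max_degree (cartesian_product G H)"
      using P.max_degree_attained[OF nonempty] .
    then obtain u w where "u \<in> pverts G" "w \<in> pverts H"
        and "out_degree (cartesian_product G H) (u, w) = max_degree (cartesian_product G H)"
      by (auto simp: pverts_cartesian_product)
    then show "max_degree (cartesian_product G H) \<le> max_degree G + max_degree H"
      using deg[of u w] G.max_degree_ge[of u] H.max_degree_ge[of w] by linarith
  next
    obtain u where u: "u \<in> pverts G" "out_degree G u = max_degree G"
      using G.max_degree_attained[OF assms(3)] .
    obtain w where w: "w \<in> pverts H" "out_degree H w = max_degree H"
      using H.max_degree_attained[OF assms(4)] .
    show "max_degree G + max_degree H \<le> max_degree (cartesian_product G H)"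
      using P.max_degree_ge[of "(u, w)"] deg[of u w] u w
      by (simp add: pverts_cartesian_product)
  qed
qed

theorem theorem3p4:
  fixes G :: "'a pair_pre_digraph" and H :: "'b pair_pre_digraph" and m n :: nat
  assumes "pair_graph G" and "pair_graph H"
    and "card (pverts G) = m" and "m \<ge> 1"
    and "card (pverts H) = n" and "n \<ge> 1"
  shows "ds_domination_number (cartesian_product G H) = m * n
           \<longleftrightarrow> max_degree G + max_degree H \<le> 1"
proof -
  interpret P: pair_graph "cartesian_product G H"
    by (rule pair_graph_cartesian_product) fact+
  have "pverts G \<noteq> {}" "pverts H \<noteq> {}"
    using assms(3-6) by auto
  then show ?thesis
    using P.ds_domination_number_eq_order_iff max_degree_cartesian_product[OF assms(1,2)] assms(3,5)
    by (simp add: pverts_cartesian_product card_cartesian_product)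
qed

end
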